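(* Let $h_1,\dots,h_N:\mathbb{S}\to\mathbb{R}$ and suppose $\bm h=[h_j]_{j=1,\dots,N}$ is a valid composite flow matching barrier function (with associated functions $\varphi_1(\cdot,\cdot),\dots,\varphi_N(\cdot,\cdot)$) for the guided flow matching model $$\frac{\mathrm{d}\mathcal{T}_t}{\mathrm{d}t}=\bm v^{\bm\theta}_t(\mathcal{T}_t)+\bm u_t,\qquad t\in[0,1],\qquad \mathcal{T}_0\sim p_0 .$$ Suppose that for every $t\in[0,1)$ the term $\bm u_t=[(\bm u_t^0)^\top,\dots,(\bm u_t^H)^\top]^\top$ is chosen from $\mathbb{U}_t=\prod_{k=0}^H\mathbb{U}_t^k$ with $\mathbb{U}_t^k=\bigcap_{j=1}^N\mathbb{U}_{j,t}^k$ and $$\mathbb{U}_{j,t}^k=\Big\{\bm u_t^k\in\mathbb{R}^{d_s}\ :\ \frac{\mathrm{d}h_j}{\mathrm{d}\bm s}(\bm E_k\mathcal{T}_t)\,\bm E_k\bm v_t^{\bm\theta}(\mathcal{T}_t)+\frac{\mathrm{d}h_j}{\mathrm{d}\bm s}(\bm E_k\mathcal{T}_t)\,\bm u_t^k+\varphi_j\big(t,h_j(\bm E_k\mathcal{T}_t)\big)\,h_j(\bm E_k\mathcal{T}_t)\ge 0\Big\}$$ for all $j=1,\dots,N$ and $k=0,\dots,H$. Then the flow matching process is composite safe with respect to $\bm h$: for every initial sample $\mathcal{T}_0\sim p_0$, the generated trajectory $\mathcal{T}_1$ satisfies $h_j(\bm E_k\mathcal{T}_1)\ge 0$ for all $k=0,\dots,H$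 and all $j=1,\dots,N$.
   Context: Setting. $d_s,H,N\in\mathbb{N}_{>0}$, $d=(H+1)d_s$, $\mathbb{S}\subseteq\mathbb{R}^{d_s}$ is the state space. A trajectory is a vector $\mathcal{T}=[(\bm s^0)^\top,\dots,(\bm s^H)^\top]^\top\in\mathbb{R}^d$ with $\bm s^k\in\mathbb{R}^{d_s}$. The selection matrices $\bm E_k=[\bm 0_{d_s\times kd_s},\bm I_{d_s},\bm 0_{d_s\times(H-k)d_s}]\in\mathbb{R}^{d_s\times d}$ satisfy $\bm s^k=\bm E_k\mathcal{T}$. The functions $h_j:\mathbb{S}\to\mathbb{R}$, $j=1,\dots,N$, are differentiable and continuous, with derivatives $\mathrm{d}h_j/\mathrm{d}\bm s$ regarded as row vectors; it is understood that the states $\bm E_k\mathcal{T}_t$ at which they are evaluated lie in $\mathbb{S}$. The composite safe set is $\mathbb{C}_s=\bigcap_{j=1}^N\{\bm s\in\mathbb{S}:h_j(\bm s)\ge 0\}$. Guided flow matching. $\bm v^{\bm\theta}:[0,1]\times\mathbb{R}^d\to\mathbb{R}^d$ is a (learned) time-dependent vector field, $\bm v_t^{\bm\theta}=\bm v^{\bm\theta}(t,\cdot)$, $\bm u_t\in\mathbb{R}^d$ is a guidance (regularization) term with blocks $\bm u_t^k\in\mathbb{R}^{d_s}$, and $p_0$ is a prior distribution on $\mathbb{R}^d$ (the initial sample need not be safe). For an initial sample $\mathcal{T}_0$, the curve $t\mapsto\mathcal{T}_t$ on $[0,1]$ is the solution of the guided ODE in the claim starting at $\mathcal{T}_0$;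 the generated trajectory is $\mathcal{T}_1$. Composite flow matching barrier function (CFMBF). $\bm h=[h_j]_{j=1,\dots,N}$ is a (valid) CFMBF if for all $k=0,\dots,H$ and $t\in[0,1)$ there exists $\bm u_t^k\in\mathbb{R}^{d_s}$ such that for all $j=1,\dots,N$ $$\frac{\mathrm{d}h_j}{\mathrm{d}\bm s}(\bm E_k\mathcal{T}_t)\bm E_k\bm v_t^{\bm\theta}(\mathcal{T}_t)+\frac{\mathrm{d}h_j}{\mathrm{d}\bm s}(\bm E_k\mathcal{T}_t)\bm u_t^k+\varphi_j(t,h_j(\bm E_k\mathcal{T}_t))h_j(\bm E_k\mathcal{T}_t)\ge 0,$$ where each $\varphi_j:[0,1)\times\mathbb{R}\to\mathbb{R}_{>0}$ has the form $\varphi_j(t,h)=\varphi_{0,j}$ if $h\ge 0$ and $\varphi_j(t,h)=\varphi_{1,j}(t)$ otherwise, with a constant $\varphi_{0,j}\in\mathbb{R}_{>0}$ and a monotonically increasing function $\varphi_{1,j}:[0,1)\to\mathbb{R}_{>0}$ satisfying $\int_0^{1^-}\varphi_{1,j}(s)\,\mathrm{d}s=\infty$. *)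

theory Defs
  imports "HOL-Probability.Probability"
begin

text \<open>
  A trajectory with blocks indexed by the finite type \<open>'k\<close> and states in \<open>real ^ 's\<close> is the
  stacked vector of type \<open>real ^ ('k \<times> 's)\<close>; its entry \<open>(k, i)\<close> is coordinate \<open>i\<close> of the
  \<open>k\<close>-th state. Taking \<open>CARD('k) = H + 1\<close> gives dimension \<open>(H + 1) * CARD('s)\<close>.
  The selection matrix of block \<open>k\<close> is the identity on that block and zero elsewhere.
\<close>

definition selection_matrix :: "'k::finite \<Rightarrow> real ^ ('k \<times> 's::finite) ^ 's" where
  "selection_matrix k = (\<chi> i. \<chi> p. if p = (k, i) then 1 else 0)"

lemma selection_matrix_nth: "(selection_matrix k *v x) $ i = x $ (k, i)"
  by (simp add: selection_matrix_def matrix_vector_mult_def if_distrib[of "\<lambda>c. c * _"]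
      cong: if_cong)

text \<open>
  The divergence condition is the improper integral from \<open>0\<close> to \<open>1\<close> from the left; the integrals
  over \<open>{0..b}\<close> with \<open>b < 1\<close> exist because the integrand is monotone there.
\<close>

definition barrier_rate :: "(real \<Rightarrow> real \<Rightarrow> real) \<Rightarrow> bool" where
  "barrier_rate \<phi> \<longleftrightarrow>
    (\<exists>\<phi>\<^sub>0 \<phi>\<^sub>1. 0 < \<phi>\<^sub>0 \<and> (\<forall>t\<in>{0..<1}. 0 < \<phi>\<^sub>1 t) \<and> mono_on {0..<1} \<phi>\<^sub>1 \<and>
      filterlim (\<lambda>b. integral {0..b} \<phi>\<^sub>1) at_top (at_left 1) \<and>
      (\<forall>t\<in>{0..<1}. \<forall>y. \<phi> t y = (if y \<ge> 0 then \<phi>\<^sub>0 else \<phi>\<^sub>1 t)))"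

text \<open>
  In the following definitions \<open>dh j s\<close> is the derivative of \<open>h j\<close> at \<open>s\<close>, as a (row) vector that
  acts on increments by the inner product, and \<open>x\<close> is the trajectory at time \<open>t\<close>.
\<close>

definition barrier_condition ::
  "(nat \<Rightarrow> real ^ 's \<Rightarrow> real) \<Rightarrow> (nat \<Rightarrow> real ^ 's \<Rightarrow> real ^ 's) \<Rightarrow> (nat \<Rightarrow> real \<Rightarrow> real \<Rightarrow> real) \<Rightarrow>
   (real \<Rightarrow> real ^ ('k::finite \<times> 's::finite) \<Rightarrow> real ^ ('k \<times> 's)) \<Rightarrow>
   real \<Rightarrow> real ^ ('k \<times> 's) \<Rightarrow> nat \<Rightarrow> 'k \<Rightarrow> real ^ 's \<Rightarrow> bool" where
  "barrier_condition h dh \<phi> v t x j k w \<longleftrightarrow>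
    (let s = selection_matrix k *v x
     in dh j s \<bullet> (selection_matrix k *v v t x) + dh j s \<bullet> w + \<phi> j t (h j s) * h j s \<ge> 0)"

text \<open>
  Validity of a composite flow matching barrier function refers to the states visited by the
  generated curve \<open>T\<close>.
\<close>

definition CFMBF ::
  "nat \<Rightarrow> (nat \<Rightarrow> real ^ 's \<Rightarrow> real) \<Rightarrow> (nat \<Rightarrow> real ^ 's \<Rightarrow> real ^ 's) \<Rightarrow> (nat \<Rightarrow> real \<Rightarrow> real \<Rightarrow> real) \<Rightarrow>
   (real \<Rightarrow> real ^ ('k::finite \<times> 's::finite) \<Rightarrow> real ^ ('k \<times> 's)) \<Rightarrow>
   (real \<Rightarrow> real ^ ('k \<times> 's)) \<Rightarrow> bool" where
  "CFMBF N h dh \<phi> v T \<longleftrightarrow>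
    (\<forall>j\<in>{1..N}. barrier_rate (\<phi> j)) \<and>
    (\<forall>k. \<forall>t\<in>{0..<1}. \<exists>w. \<forall>j\<in>{1..N}. barrier_condition h dh \<phi> v t (T t) j k w)"

definition guidance_block_set_single ::
  "(nat \<Rightarrow> real ^ 's \<Rightarrow> real) \<Rightarrow> (nat \<Rightarrow> real ^ 's \<Rightarrow> real ^ 's) \<Rightarrow> (nat \<Rightarrow> real \<Rightarrow> real \<Rightarrow> real) \<Rightarrow>
   (real \<Rightarrow> real ^ ('k::finite \<times> 's::finite) \<Rightarrow> real ^ ('k \<times> 's)) \<Rightarrow>
   real \<Rightarrow> real ^ ('k \<times> 's) \<Rightarrow> nat \<Rightarrow> 'k \<Rightarrow> (real ^ 's) set" where
  "guidance_block_set_single h dh \<phi> v t x j k = {w. barrier_condition h dh \<phi> v t x j k w}"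

definition guidance_block_set ::
  "nat \<Rightarrow> (nat \<Rightarrow> real ^ 's \<Rightarrow> real) \<Rightarrow> (nat \<Rightarrow> real ^ 's \<Rightarrow> real ^ 's) \<Rightarrow> (nat \<Rightarrow> real \<Rightarrow> real \<Rightarrow> real) \<Rightarrow>
   (real \<Rightarrow> real ^ ('k::finite \<times> 's::finite) \<Rightarrow> real ^ ('k \<times> 's)) \<Rightarrow>
   real \<Rightarrow> real ^ ('k \<times> 's) \<Rightarrow> 'k \<Rightarrow> (real ^ 's) set" where
  "guidance_block_set N h dh \<phi> v t x k =
    (\<Inter>j\<in>{1..N}. guidance_block_set_single h dh \<phi> v t x j k)"

definition guidance_set ::
  "nat \<Rightarrow> (nat \<Rightarrow> real ^ 's \<Rightarrow> real) \<Rightarrow> (nat \<Rightarrow> real ^ 's \<Rightarrow> real ^ 's) \<Rightarrow> (nat \<Rightarrow> real \<Rightarrow> real \<Rightarrow> real) \<Rightarrow>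
   (real \<Rightarrow> real ^ ('k::finite \<times> 's::finite) \<Rightarrow> real ^ ('k \<times> 's)) \<Rightarrow>
   real \<Rightarrow> real ^ ('k \<times> 's) \<Rightarrow> (real ^ ('k \<times> 's)) set" where
  "guidance_set N h dh \<phi> v t x =
    {u. \<forall>k. selection_matrix k *v u \<in> guidance_block_set N h dh \<phi> v t x k}"

definition guided_flow_solution ::
  "(real \<Rightarrow> 'a \<Rightarrow> 'a) \<Rightarrow> (real \<Rightarrow> 'a) \<Rightarrow> (real \<Rightarrow> 'a::real_normed_vector) \<Rightarrow> bool" where
  "guided_flow_solution v u T \<longleftrightarrow>
    (\<forall>t\<in>{0..1}. (T has_vector_derivative v t (T t) + u t) (at t within {0..1}))"

text \<open>Safety is required for every outcome of the initial sampling, not just almost surely.\<close>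

definition composite_safe ::
  "'w measure \<Rightarrow> nat \<Rightarrow> (nat \<Rightarrow> real ^ 's \<Rightarrow> real) \<Rightarrow>
   ('w \<Rightarrow> real \<Rightarrow> real ^ ('k::finite \<times> 's::finite)) \<Rightarrow> bool" where
  "composite_safe M N h T \<longleftrightarrow>
    (\<forall>\<omega>\<in>space M. \<forall>k. \<forall>j\<in>{1..N}. h j (selection_matrix k *v T \<omega> 1) \<ge> 0)"

end

theory Submission
  imports Defs
begin

text \<open>
  Suppose a component \<open>y t = h j (E k T\<^sub>t)\<close> satisfied \<open>y 1 < 0\<close>. By continuity there is \<open>c > 0\<close>
  with \<open>y \<le> - c\<close> near \<open>1\<close>, where the barrier condition reads \<open>y' \<ge> - \<phi>\<^sub>1 y \<ge> c \<phi>\<^sub>1\<close>. Integrating,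
  \<open>y\<close> would grow at least like \<open>c\<close> times the divergent integral of \<open>\<phi>\<^sub>1\<close>, although it stays negative.
\<close>

text \<open>For the gauge integral, a derivative is always integrable with the expected value. So
  \<open>y'\<close>, which may inherit irregularity from the guidance term, can be compared with
  \<open>f\<close> under the integral sign.\<close>

lemma bounded_growth_if_derivative_ge:
  fixes y y' f :: "real \<Rightarrow> real"
  assumes "a \<le> b"
    and "\<And>t. t \<in> {a..b} \<Longrightarrow> (y has_real_derivative y' t) (at t within {a..b})"
    and "f integrable_on {a..b}"
    and "\<And>t. t \<in> {a..b} \<Longrightarrow> f t \<le> y' t"
  shows "integral {a..b} f \<le> y b - y a"
proof -
  have "(y' has_integral (y b - y a)) {a..b}"
    using assms by (intro fundamental_theorem_of_calculus)
      (auto simp: has_real_derivative_iff_has_vector_derivative)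
  with assms show ?thesis
    by (intro has_integral_le[OF integrable_integral]) auto
qed

lemma barrier_nonneg_at_one:
  fixes y y' :: "real \<Rightarrow> real"
  assumes rate: "barrier_rate \<phi>"
    and deriv: "\<And>t. t \<in> {0..1} \<Longrightarrow> (y has_real_derivative y' t) (at t within {0..1})"
    and barrier: "\<And>t. t \<in> {0..<1} \<Longrightarrow> y' t + \<phi> t (y t) * y t \<ge> 0"
  shows "y 1 \<ge> 0"
proof (rule ccontr)
  assume neg: "\<not> y 1 \<ge> 0"
  from rate obtain \<phi>\<^sub>0 \<phi>\<^sub>1 where pos: "\<forall>t\<in>{0..<1}. 0 < \<phi>\<^sub>1 t"
    and mono: "mono_on {0..<1} \<phi>\<^sub>1"
    and diverges: "filterlim (\<lambda>b. integral {0..b} \<phi>\<^sub>1) at_top (at_left 1)"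
    and \<phi>: "\<forall>t\<in>{0..<1}. \<forall>y. \<phi> t y = (if y \<ge> 0 then \<phi>\<^sub>0 else \<phi>\<^sub>1 t)"
    unfolding barrier_rate_def by blast
  \<comment> \<open>Half of the distance of \<open>y 1\<close> from 0 leaves \<open>y 1\<close>
    strictly below \<open>- c\<close>, so continuity can carry this bound to times before 1.\<close>
  define c where "c = - y 1 / 2"
  have c: "c > 0" "y 1 < - c" using neg by (auto simp: c_def)
  have "continuous (at 1 within {0..1}) y"
    using deriv[of 1] by (auto intro: DERIV_continuous)
  then have "((\<lambda>t. y t) \<longlongrightarrow> y 1) (at 1 within {0..1})"
    by (simp add: continuous_within)
  then have "eventually (\<lambda>t. y t < - c) (at 1 within {0..1})"
    using c order_tendstoD(2) by blast
  then have "eventually (\<lambda>t. y t < - c) (at_left 1)"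
    by (simp add: at_within_Icc_at_left)
  then obtain a' where a': "a' < 1" "\<And>t. a' < t \<Longrightarrow> t < 1 \<Longrightarrow> y t < - c"
    by (auto simp: eventually_at_left_field)
  \<comment> \<open>The midpoint lies strictly to the right of \<open>a'\<close>, so the bound on
    \<open>y\<close> holds already at \<open>a\<close>; the maximum keeps \<open>a\<close> in the
    time domain.\<close>
  define a where "a = max 0 ((a' + 1) / 2)"
  have a: "0 \<le> a" "a < 1" "a' < a" using a' by (auto simp: a_def max_def field_simps)
  have y_less: "y t < - c" if "t \<in> {a..<1}" for t using a a' that by auto
  \<comment> \<open>Stopping short of 1 keeps the compact interval inside the set where the rate is
    monotone.\<close>
  have integrable: "\<phi>\<^sub>1 integrable_on {r..b}" if "0 \<le> r" "b < 1" for r b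
    using that by (intro integrable_on_mono_on mono_on_subset[OF mono]) auto
  \<comment> \<open>The right-hand side does not depend on \<open>b\<close>, which will contradict
    divergence as \<open>b\<close> tends to 1.\<close>
  have bound: "integral {0..b} \<phi>\<^sub>1 \<le> integral {0..a} \<phi>\<^sub>1 + (- c - y a) / c" if b: "b \<in> {a..<1}" for b
  proof -
    have "integral {a..b} (\<lambda>t. c * \<phi>\<^sub>1 t) \<le> y b - y a"
    proof (rule bounded_growth_if_derivative_ge)
      show "(\<lambda>t. c * \<phi>\<^sub>1 t) integrable_on {a..b}"
        using integrable[of a b] a b by (auto intro: integrable_on_mult_right)
      show "(y has_real_derivative y' t) (at t within {a..b})" if "t \<in> {a..b}" for t
        using deriv[of t] a b that by (auto intro: DERIV_subset)
      show "c * \<phi>\<^sub>1 t \<le> y' t" if t: "t \<in> {a..b}" for t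
      proof -
        have "t \<in> {0..<1}" and y: "y t < - c" using a b t y_less[of t] by auto
        \<comment> \<open>Since \<open>y t\<close> is negative, the two-case rate takes its
          time-dependent branch.\<close>
        then have "y' t + \<phi>\<^sub>1 t * y t \<ge> 0"
          using barrier[of t] \<phi> c by simp
        moreover have "\<phi>\<^sub>1 t * y t \<le> \<phi>\<^sub>1 t * - c"
          using y pos \<open>t \<in> {0..<1}\<close> by (intro mult_left_mono) (simp_all add: less_imp_le)
        ultimately show ?thesis by (simp add: mult.commute)
      qed
    qed (use b in auto)
    also have "\<dots> \<le> - c - y a" using y_less[OF b] by simp
    finally have "integral {a..b} \<phi>\<^sub>1 \<le> (- c - y a) / c" using c by (simp add: field_simps)
    moreover have "integral {0..a} \<phi>\<^sub>1 + integral {a..b} \<phi>\<^sub>1 = integral {0..b} \<phi>\<^sub>1"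
      using a b integrable[of 0 b] by (intro Henstock_Kurzweil_Integration.integral_combine) auto
    ultimately show ?thesis by simp
  qed
  have "eventually (\<lambda>b. b \<in> {a..<1}) (at_left 1)"
    using a by (auto simp: eventually_at_left_field)
  moreover have "eventually (\<lambda>b. integral {0..a} \<phi>\<^sub>1 + (- c - y a) / c < integral {0..b} \<phi>\<^sub>1) (at_left 1)"
    using diverges by (simp add: filterlim_at_top_dense)
  \<comment> \<open>There are points arbitrarily close to 1 from the left, so nothing false can hold
    eventually there.\<close>
  ultimately have "eventually (\<lambda>b. False) (at_left (1::real))"
    by eventually_elim (use bound in force)
  then show False by (simp add: trivial_limit_at_left_real)
qed

theorem theorem2:
  fixes S :: "(real ^ 's::finite) set"
    and H N :: nat
    and h :: "nat \<Rightarrow> real ^ 's \<Rightarrow> real"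
    and dh :: "nat \<Rightarrow> real ^ 's \<Rightarrow> real ^ 's"
    and \<phi> :: "nat \<Rightarrow> real \<Rightarrow> real \<Rightarrow> real"
    and v :: "real \<Rightarrow> real ^ ('k::finite \<times> 's) \<Rightarrow> real ^ ('k \<times> 's)"
    and p\<^sub>0 :: "(real ^ ('k \<times> 's)) measure"
    and M :: "'w measure"
    and u T :: "'w \<Rightarrow> real \<Rightarrow> real ^ ('k \<times> 's)"
  assumes "H > 0" and "CARD('k) = H + 1" and "N > 0"
    and "\<And>j. j \<in> {1..N} \<Longrightarrow> continuous_on S (h j)"
    and "\<And>j s. j \<in> {1..N} \<Longrightarrow> s \<in> S \<Longrightarrow>
           (h j has_derivative (\<lambda>y. dh j s \<bullet> y)) (at s within S)"
    and "prob_space M"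
    and "(\<lambda>\<omega>. T \<omega> 0) \<in> borel_measurable M"
    and "distr M borel (\<lambda>\<omega>. T \<omega> 0) = p\<^sub>0"
    and "\<And>\<omega>. \<omega> \<in> space M \<Longrightarrow> guided_flow_solution v (u \<omega>) (T \<omega>)"
    and "\<And>\<omega> t k. \<omega> \<in> space M \<Longrightarrow> t \<in> {0..1} \<Longrightarrow> selection_matrix k *v T \<omega> t \<in> S"
    and "\<And>\<omega>. \<omega> \<in> space M \<Longrightarrow> CFMBF N h dh \<phi> v (T \<omega>)"
    and "\<And>\<omega> t. \<omega> \<in> space M \<Longrightarrow> t \<in> {0..<1} \<Longrightarrow>
           u \<omega> t \<in> guidance_set N h dh \<phi> v t (T \<omega> t)"
  shows "composite_safe M N h T"
  unfolding composite_safe_def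
proof (intro ballI allI)
  fix \<omega> k j
  assume \<omega>: "\<omega> \<in> space M" and j: "j \<in> {1..N}"
  \<comment> \<open>Safety splits into one scalar claim per outcome, block and constraint. Here
    \<open>x\<close> is the curve of the \<open>k\<close>-th state and \<open>w\<close> its velocity
    under the guided ODE.\<close>
  define x where "x t = selection_matrix k *v T \<omega> t" for t
  define w where "w t = selection_matrix k *v (v t (T \<omega> t) + u \<omega> t)" for t
  have "h j (x 1) \<ge> 0"
  proof (rule barrier_nonneg_at_one)
    show "barrier_rate (\<phi> j)" using assms(11)[OF \<omega>] j by (auto simp: CFMBF_def)
  next
    fix t :: real
    assume t: "t \<in> {0..1}"
    have "(T \<omega> has_vector_derivative v t (T \<omega> t) + u \<omega> t) (at t within {0..1})"
      using assms(9)[OF \<omega>] t by (auto simp: guided_flow_solution_def)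
    then have x: "(x has_vector_derivative w t) (at t within {0..1})"
      unfolding x_def w_def
      by (rule bounded_linear.has_vector_derivative[OF matrix_vector_mul_bounded_linear])
    \<comment> \<open>As \<open>h j\<close> is differentiable only relative to \<open>S\<close>, the
      chain rule is applied within the image of the curve, which stays in \<open>S\<close>.\<close>
    have "x ` {0..1} \<subseteq> S" using assms(10)[OF \<omega>] by (auto simp: x_def)
    then have "(h j has_derivative (\<lambda>y. dh j (x t) \<bullet> y)) (at (x t) within x ` {0..1})"
      using assms(5)[OF j, of "x t"] t by (meson has_derivative_subset image_eqI subsetD)
    then have "((h j \<circ> x) has_vector_derivative dh j (x t) \<bullet> w t) (at t within {0..1})"
      by (rule vector_derivative_diff_chain_within[OF x])
    then show "((\<lambda>t. h j (x t)) has_real_derivative dh j (x t) \<bullet> w t) (at t within {0..1})"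
      by (simp add: has_real_derivative_iff_has_vector_derivative o_def)
  next
    fix t :: real
    assume t: "t \<in> {0..<1}"
    have "barrier_condition h dh \<phi> v t (T \<omega> t) j k (selection_matrix k *v u \<omega> t)"
      using assms(12)[OF \<omega> t] j
      by (auto simp: guidance_set_def guidance_block_set_def guidance_block_set_single_def)
    \<comment> \<open>By linearity, \<open>w t\<close> splits into the blocks of the learned field
      and of the guidance, giving the two inner products of the barrier condition.\<close>
    then show "dh j (x t) \<bullet> w t + \<phi> j t (h j (x t)) * h j (x t) \<ge> 0"
      by (simp add: barrier_condition_def Let_def x_def w_def matrix_vector_right_distrib inner_add_right)
  qed
  then show "h j (selection_matrix k *v T \<omega> 1) \<ge> 0" by (simp add: x_def)
qed

end
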